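(* For all $\delta\in(0,1]$ there exists a pair $(\phi_1^\delta,\psi_1^\delta)\in(\mathcal{PC})$ such that \[ \widehat{\psi_1^\delta}\bigl(t^{-1}\bigr)\sim \bigl(\log(t)\bigr)^\delta\quad\text{as } t\to\infty, \] and \[ \widehat{\psi_1^\delta}\bigl(t^{-1}\bigr)\sim \bigl(t\cdot\log(t^{-1})\bigr)^{\delta}\quad\text{as } t\to0^+ . \]
   Context: Notation: $\mathbb{R}_+=[0,\infty)$; $(f\ast g)(t)=\int_0^t f(t-s)g(s)\,ds$; $\widehat{f}(\lambda)=\int_0^\infty e^{-\lambda t}f(t)\,dt$ for $\lambda>0$ is the Laplace transform; $f(t)\sim g(t)$ as $t\to t_*$ means $\lim_{t\to t_*}f(t)/g(t)=1$. $(k,\ell)\in(\mathcal{PC})$ means that $k\in L_{1,loc}(\mathbb{R}_+)$ is nonnegative and nonincreasing, $\ell\in L_{1,loc}(\mathbb{R}_+)$, and $(k\ast\ell)=1$ on $(0,\infty)$. The superscript $\delta$ in $\phi_1^\delta,\psi_1^\delta$ is a label, not a power. *)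

theory Defs
  imports "HOL-Analysis.Analysis" "HOL-Library.Landau_Symbols"
begin

text \<open>
  Functions on the half-line are total functions \<open>real \<Rightarrow> real\<close> of which only the values on
  \<open>{0..}\<close> matter.
\<close>

definition L1_loc :: "(real \<Rightarrow> real) \<Rightarrow> bool" where
  "L1_loc f \<longleftrightarrow> (\<forall>T>0. f absolutely_integrable_on {0..T})"

definition convolution :: "(real \<Rightarrow> real) \<Rightarrow> (real \<Rightarrow> real) \<Rightarrow> real \<Rightarrow> real" where
  "convolution f g t = (LINT s:{0..t}|lebesgue. f (t - s) * g s)"

definition laplace_transform :: "(real \<Rightarrow> real) \<Rightarrow> real \<Rightarrow> real" where
  "laplace_transform f p = (LINT t:{0..}|lebesgue. exp (- p * t) * f t)"

text \<open>
  The kernel \<open>k\<close> may be unbounded near \<open>0\<close>, where a real-valued representative has no meaningful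
  value; its sign and monotonicity are therefore required on \<open>{0<..}\<close> only. The identity
  \<open>k * l = 1\<close> is imposed at every \<open>t > 0\<close>; as a non-integrable integrand has integral \<open>0\<close>,
  it includes that the convolution integral exists.
\<close>

definition PC :: "(real \<Rightarrow> real) \<Rightarrow> (real \<Rightarrow> real) \<Rightarrow> bool" where
  "PC k l \<longleftrightarrow>
     L1_loc k \<and> (\<forall>t>0. 0 \<le> k t) \<and> antimono_on {0<..} k \<and>
     L1_loc l \<and> (\<forall>t>0. convolution k l t = 1)"

end

theory Submission
  imports Defs "HOL-Probability.Helly_Selection" "HOL-Real_Asymp.Real_Asymp"
begin

text \<open>
  Let \<open>Lam t = (1 + t) ln (1 + t) - t ln t\<close> be the primitive of \<open>ln (1 + 1 / t)\<close>, which behaves like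
  \<open>t ln (1 / t)\<close> at \<open>0\<close> and like \<open>ln t\<close> at infinity, and put
  \<open>\<psi> = (\<lambda>t. Lam (c t) powr \<delta>)'\<close>. An Abelian argument (dominated convergence in
  \<open>\<integral> exp (- u) Lam (c u t) powr \<delta> du\<close>) shows that the Laplace transform of \<open>\<psi>\<close> has the required
  behaviour at infinity for every \<open>c\<close>, and at \<open>0\<close> up to the factor \<open>c powr \<delta> * Gamma (1 + \<delta>)\<close>, which
  \<open>c\<close> normalises to \<open>1\<close>.

  The kernel \<open>\<psi>\<close> is positive, decreasing, log-convex and unbounded at \<open>0\<close>, and any such kernel has a
  nonnegative nonincreasing partner \<open>\<phi>\<close>. On a grid of width \<open>h\<close> the integrals of \<open>\<psi>\<close> over the cells form a
  decreasing log-convex sequence, so by Kaluza's theorem the inverse step function is nonnegative and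
  nonincreasing, and its convolution with \<open>\<psi>\<close> is exactly \<open>1\<close> at the grid points. Helly's selection
  theorem provides a limit for \<open>h\<close> tending to \<open>0\<close>; since \<open>\<psi>\<close> is unbounded at \<open>0\<close>, no mass of the step
  functions concentrates there.
\<close>

section \<open>Log-convex kernels\<close>

text \<open>Let D, with coefficients \<open>d\<close>, be the inverse of the power series A of
  \<open>a\<close>. By induction, log-convexity forces \<open>d n\<close> to be nonpositive for n >
  0. The partial sums \<open>b\<close> of \<open>d\<close> are the coefficients of D / (1 - X), so A
  times their series is 1 / (1 - X), which is the convolution identity; the signs of
  \<open>d\<close> make \<open>b\<close> nonincreasing.\<close>

lemma kaluza:
  fixes a :: "nat \<Rightarrow> real"
  assumes pos: "\<And>n. 0 < a n"
    and logconvex: "\<And>n. a (Suc n) * a (Suc n) \<le> a n * a (Suc (Suc n))"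
    and dec: "decseq a"
  obtains b where "\<And>n. 0 \<le> b n" "decseq b" "\<And>n. (\<Sum>k\<le>n. a k * b (n - k)) = 1"
proof -
  define d where "d n = fps_nth (inverse (Abs_fps a)) n" for n
  define b where "b n = (\<Sum>k\<le>n. d k)" for n
  have "Abs_fps d = inverse (Abs_fps a)"
    by (intro fps_ext) (simp add: d_def)
  then have inv: "Abs_fps d * Abs_fps a = 1"
    using inverse_mult_eq_1[of "Abs_fps a"] pos[of 0] by simp
  have conv: "(\<Sum>k\<le>n. d k * a (n - k)) = (if n = 0 then 1 else 0)" for n
    using arg_cong[OF inv, of "\<lambda>f. fps_nth f n"] by (simp add: fps_mult_nth atMost_atLeast0)
  \<comment> \<open>Log-convexity in the form used below: the quotients of consecutive terms are
    nondecreasing.\<close>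
  have ratio: "a k * a (Suc n) \<ge> a (Suc k) * a n" if "k \<le> n" for k n
    using that
  proof (induction n rule: dec_induct)
    case base
    then show ?case by simp
  next
    case (step n)
    have "a (Suc k) * a (Suc n) * a (Suc n) \<le> a (Suc k) * (a n * a (Suc (Suc n)))"
      using mult_left_mono[OF logconvex[of n], of "a (Suc k)"] pos[of "Suc k"] by (simp add: mult_ac)
    also have "\<dots> \<le> a k * a (Suc n) * a (Suc (Suc n))"
      using mult_right_mono[OF step.IH, of "a (Suc (Suc n))"] pos[of "Suc (Suc n)"]
      by (simp add: mult_ac)
    finally have "a (Suc k) * a (Suc n) * a (Suc n) \<le> a k * a (Suc (Suc n)) * a (Suc n)"
      by (simp add: mult_ac)
    then show ?case using pos[of "Suc n"] by simp
  qed
  have d0: "d 0 > 0"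
    using conv[of 0] pos[of 0] zero_less_mult_iff[of "d 0" "a 0"] by auto
  have dneg: "d n \<le> 0" if "n \<ge> 1" for n
    using that
  proof (induction n rule: less_induct)
    case (less m)
    then obtain n where m: "m = Suc n" by (cases m) auto
    have 1: "(\<Sum>k\<le>n. d k * a (Suc n - k)) = - d (Suc n) * a 0"
      using conv[of "Suc n"] by simp
    show ?case
    proof (cases "n = 0")
      case True
      then have "d (Suc 0) * a 0 = - (d 0 * a (Suc 0))" using 1 by simp
      moreover have "0 < d 0 * a (Suc 0)" using d0 pos by simp
      ultimately have "d (Suc 0) * a 0 < 0" by linarith
      then show ?thesis using True m pos[of 0] by (simp add: mult_less_0_iff)
    next
      case False
      have 2: "(\<Sum>k\<le>n. d k * a (n - k)) = 0" using conv[of n] False by simp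
      \<comment> \<open>Two consecutive convolution identities are cross-multiplied and subtracted.
        The term k = 0, the only one with positive \<open>d k\<close>, cancels, and every other term
        is a product of two nonpositive factors.\<close>
      have "- d (Suc n) * a 0 * a n =
          (\<Sum>k\<le>n. d k * a (Suc n - k)) * a n - (\<Sum>k\<le>n. d k * a (n - k)) * a (Suc n)"
        using 1 2 by simp
      also have "\<dots> = (\<Sum>k\<le>n. d k * (a (Suc (n - k)) * a n - a (n - k) * a (Suc n)))"
        unfolding sum_distrib_right sum_subtractf[symmetric]
        by (intro sum.cong) (auto simp: algebra_simps Suc_diff_le)
      also have "\<dots> \<ge> 0"
      proof (intro sum_nonneg)
        fix k assume k: "k \<in> {..n}"
        show "0 \<le> d k * (a (Suc (n - k)) * a n - a (n - k) * a (Suc n))"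
        proof (cases "k = 0")
          case False
          then have "d k \<le> 0" using less.IH[of k] k m by auto
          moreover have "a (Suc (n - k)) * a n - a (n - k) * a (Suc n) \<le> 0"
            using ratio[of "n - k" n] by simp
          ultimately show ?thesis by (rule mult_nonpos_nonpos)
        qed simp
      qed
      finally show ?thesis using m pos[of 0] pos[of n]
        by (simp add: zero_le_mult_iff mult_le_0_iff not_less less_imp_le)
    qed
  qed
  show ?thesis
  proof
    fix n
    show "0 \<le> b n"
    proof (cases "n = 0")
      case False
      \<comment> \<open>The convolution of \<open>d\<close> and \<open>a\<close> vanishes for n > 0
        and may be subtracted, which again removes the term k = 0.\<close>
      have "a n * b n = (\<Sum>k\<le>n. d k * (a n - a (n - k)))"
        using conv[of n] False by (simp add: b_def algebra_simps sum_subtractf sum_distrib_left)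
      also have "\<dots> \<ge> 0"
      proof (intro sum_nonneg)
        fix k assume k: "k \<in> {..n}"
        show "0 \<le> d k * (a n - a (n - k))"
        proof (cases "k = 0")
          case False
          then show ?thesis
            using dneg[of k] decseqD[OF dec, of "n - k" n] by (intro mult_nonpos_nonpos) auto
        qed simp
      qed
      finally show ?thesis using pos[of n] by (simp add: zero_le_mult_iff not_less less_imp_le)
    qed (use d0 in \<open>simp add: b_def\<close>)
    have "Abs_fps b = Abs_fps d * Abs_fps (\<lambda>_. 1)"
      by (intro fps_ext) (simp add: fps_mult_nth b_def atMost_atLeast0)
    then have "Abs_fps a * Abs_fps b = Abs_fps (\<lambda>_. 1)"
      using inv by (metis mult.commute mult.left_commute mult_1_right)
    from arg_cong[OF this, of "\<lambda>f. fps_nth f n"]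
    show "(\<Sum>k\<le>n. a k * b (n - k)) = 1"
      by (simp add: fps_mult_nth atMost_atLeast0)
  next
    show "decseq b"
      by (rule decseq_SucI) (simp add: b_def dneg)
  qed
qed

section \<open>Cell integrals of a log-convex kernel and inverse step functions on a grid\<close>

locale log_convex_kernel =
  fixes \<psi> :: "real \<Rightarrow> real"
  assumes pos: "\<And>t. 0 < t \<Longrightarrow> 0 < \<psi> t"
    and antimono: "\<And>s t. 0 < s \<Longrightarrow> s \<le> t \<Longrightarrow> \<psi> t \<le> \<psi> s"
    and log_convex: "convex_on {0<..} (\<lambda>t. ln (\<psi> t))"
    and integrable: "\<And>a b. 0 \<le> a \<Longrightarrow> \<psi> integrable_on {a..b}"
    and unbounded: "filterlim \<psi> at_top (at_right 0)"
begin

text \<open>The points x + h and y are complementary convex combinations of x and y + h; adding the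
  two convexity inequalities for the logarithm gives the claim.\<close>

lemma ratio_mono:
  assumes "0 < x" "x \<le> y" "0 \<le> h"
  shows "\<psi> (x + h) * \<psi> y \<le> \<psi> x * \<psi> (y + h)"
proof (cases "y + h = x")
  case False
  define u where "u = h / (y + h - x)"
  have u: "0 \<le> u" "u \<le> 1" and pos': "y + h - x > 0"
    using assms False by (auto simp: u_def divide_simps)
  have uh: "u * (y + h - x) = h" using pos' by (simp add: u_def)
  have 1: "(1 - u) * x + u * (y + h) = x + h" "(1 - (1 - u)) * x + (1 - u) * (y + h) = y"
    using uh by (auto simp: algebra_simps)
  have "ln (\<psi> (x + h)) \<le> (1 - u) * ln (\<psi> x) + u * ln (\<psi> (y + h))"
    using convex_onD[OF log_convex, of u x "y + h"] u assms 1 by simp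
  moreover have "ln (\<psi> y) \<le> (1 - (1 - u)) * ln (\<psi> x) + (1 - u) * ln (\<psi> (y + h))"
    using convex_onD[OF log_convex, of "1 - u" x "y + h"] u assms 1 by simp
  ultimately have "ln (\<psi> (x + h)) + ln (\<psi> y) \<le> ln (\<psi> x) + ln (\<psi> (y + h))"
    by (simp add: algebra_simps)
  moreover have "\<psi> x > 0" "\<psi> y > 0" "\<psi> (x + h) > 0" "\<psi> (y + h) > 0"
    using assms by (auto intro!: pos)
  ultimately show ?thesis
    by (metis ln_le_cancel_iff ln_mult_pos mult_pos_pos)
qed (use assms in auto)

definition step :: "real \<Rightarrow> nat \<Rightarrow> real" where
  "step h n = integral {real n * h..real (Suc n) * h} \<psi>"

text \<open>Moving the integral over the next cell back by h lets neighbouring cells be compared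
  pointwise.\<close>

lemma step_shift:
  assumes "0 < h"
  shows "((\<lambda>x. \<psi> (x + h)) has_integral step h (Suc n)) {real n * h..real (Suc n) * h}"
proof -
  have "(\<psi> has_integral step h (Suc n)) {real (Suc n) * h..real (Suc (Suc n)) * h}"
    unfolding step_def using assms by (intro integrable_integral integrable) auto
  from has_integral_affinity'[OF this[folded cbox_interval], of 1 h]
  show ?thesis by (simp add: algebra_simps)
qed

lemma step_has_integral:
  assumes "0 < h"
  shows "(\<psi> has_integral step h n) {real n * h..real (Suc n) * h}"
  unfolding step_def using assms by (intro integrable_integral integrable) auto

lemma step_pos:
  assumes "0 < h"
  shows "0 < step h n"
proof -
  let ?I = "{real n * h..real (Suc n) * h}"
  have c: "((\<lambda>_. \<psi> (real (Suc n) * h)) has_integral h * \<psi> (real (Suc n) * h)) ?I"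
    using has_integral_const_real[of "\<psi> (real (Suc n) * h)" "real n * h" "real (Suc n) * h"] assms
    by (simp add: algebra_simps)
  \<comment> \<open>Both integrands are overwritten at 0, here and in the next lemmas, because
    nothing is known about \<psi> at that point.\<close>
  have "h * \<psi> (real (Suc n) * h) \<le> step h n"
  proof (rule has_integral_le[OF has_integral_spike_finite[OF _ _ c, of "{0}"] has_integral_spike_finite[OF _ _ step_has_integral[OF assms], of "{0}"]])
    fix x assume x: "x \<in> ?I"
    show "(if x = 0 then 0 else \<psi> (real (Suc n) * h)) \<le> (if x = 0 then 0 else \<psi> x)"
    proof (cases "x = 0")
      case False
      have "0 \<le> real n * h" using assms by simp
      then have "x > 0" using x False unfolding atLeastAtMost_iff by linarith
      then show ?thesis using x by (auto intro!: antimono)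
    qed simp
  qed auto
  moreover have "0 < h * \<psi> (real (Suc n) * h)" using assms by (auto intro!: pos mult_pos_pos)
  ultimately show ?thesis by linarith
qed

lemma step_antimono:
  assumes "0 < h"
  shows "step h (Suc n) \<le> step h n"
proof -
  let ?I = "{real n * h..real (Suc n) * h}"
  show ?thesis
  proof (rule has_integral_le[OF has_integral_spike_finite[OF _ _ step_shift[OF assms], of "{0}"]
      has_integral_spike_finite[OF _ _ step_has_integral[OF assms], of "{0}"]])
    fix x assume x: "x \<in> ?I"
    show "(if x = 0 then 0 else \<psi> (x + h)) \<le> (if x = 0 then 0 else \<psi> x)"
    proof (cases "x = 0")
      case False
      have "0 \<le> real n * h" using assms by simp
      then have "x > 0" using x False unfolding atLeastAtMost_iff by linarith
      then show ?thesis using assms by (auto intro!: antimono)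
    qed simp
  qed auto
qed

text \<open>All quotients \<open>\<psi> (x + h) / \<psi> x\<close> with \<open>x\<close> in the \<open>n\<close>-th cell are at most, and those in the
  next cell at least, the quotient at their common end point.\<close>

lemma step_log_convex:
  assumes "0 < h"
  shows "step h (Suc n) * step h (Suc n) \<le> step h n * step h (Suc (Suc n))"
proof -
  define y where "y = real (Suc n) * h"
  define r where "r = \<psi> (y + h) / \<psi> y"
  have y: "y > 0" using assms by (simp add: y_def)
  have r: "r > 0" using y assms by (simp add: r_def pos)
  have "step h (Suc n) \<le> r * step h n"
  proof (rule has_integral_le[OF has_integral_spike_finite[OF _ _ step_shift[OF assms], of "{0}"]
      has_integral_spike_finite[OF _ _ has_integral_mult_right[OF step_has_integral[OF assms]], of "{0}"]])
    fix x assume x: "x \<in> {real n * h..real (Suc n) * h}"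
    show "(if x = 0 then 0 else \<psi> (x + h)) \<le> (if x = 0 then 0 else r * \<psi> x)"
    proof (cases "x = 0")
      case False
      have "0 \<le> real n * h" using assms by simp
      then have "x > 0" using x False unfolding atLeastAtMost_iff by linarith
      then have "\<psi> (x + h) * \<psi> y \<le> \<psi> x * \<psi> (y + h)"
        using assms x by (intro ratio_mono) (auto simp: y_def)
      then show ?thesis using False pos[OF y] by (simp add: r_def field_simps)
    qed simp
  qed auto
  moreover have "r * step h (Suc n) \<le> step h (Suc (Suc n))"
  proof (rule has_integral_le[OF has_integral_mult_right[OF step_has_integral[OF assms]] step_shift[OF assms]])
    fix x assume x: "x \<in> {real (Suc n) * h..real (Suc (Suc n)) * h}"
    have "\<psi> (y + h) * \<psi> x \<le> \<psi> y * \<psi> (x + h)"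
      using y assms x by (intro ratio_mono) (auto simp: y_def)
    then show "r * \<psi> x \<le> \<psi> (x + h)" using pos[OF y] by (simp add: r_def field_simps)
  qed
  ultimately have "(r * step h (Suc n)) * step h (Suc n) \<le> step h (Suc (Suc n)) * (r * step h n)"
    using r step_pos[OF assms, of n] step_pos[OF assms, of "Suc n"] step_pos[OF assms, of "Suc (Suc n)"]
    by (intro mult_mono) auto
  then have "r * (step h (Suc n) * step h (Suc n)) \<le> r * (step h n * step h (Suc (Suc n)))"
    by (simp add: mult_ac)
  then show ?thesis using r by simp
qed

text \<open>The reflection at a grid point maps cells onto cells. Hence the convolution integral of
  \<psi> with a step function reduces there to the discrete convolution inverted by
  \<open>kaluza\<close>.\<close>

lemma grid_inverse:
  assumes h: "0 < h"
  obtains g where "\<And>x. 0 \<le> g x" "antimono g" "\<And>x. continuous (at_right x) g"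
    "\<And>N. 1 \<le> N \<Longrightarrow> ((\<lambda>s. g (real N * h - s) * \<psi> s) has_integral 1) {0..real N * h}"
proof -
  obtain b where b: "\<And>n. 0 \<le> b n" "decseq b" "\<And>n. (\<Sum>k\<le>n. step h k * b (n - k)) = 1"
    using kaluza[of "step h"] step_pos[OF h] step_log_convex[OF h] decseq_SucI[of "step h", OF step_antimono[OF h]]
    by metis
  \<comment> \<open>For negative x, \<open>nat\<close> yields the index 0, so g is constant to the
    left of 0 and monotone on the whole line, as Helly's theorem requires.\<close>
  define g where "g x = b (nat \<lfloor>x / h\<rfloor>)" for x
  show ?thesis
  proof
    show "0 \<le> g x" for x by (simp add: g_def b)
    show "antimono g"
      unfolding g_def using h
      by (intro antimonoI decseqD[OF b(2)] nat_mono floor_mono) (simp add: divide_right_mono)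
    show "continuous (at_right x) g" for x
    proof -
      define u where "u = (real_of_int \<lfloor>x / h\<rfloor> + 1) * h"
      have "x / h < real_of_int \<lfloor>x / h\<rfloor> + 1" by linarith
      then have "x < u" using h by (simp add: u_def field_simps)
      then have "eventually (\<lambda>y. y \<in> {x<..<u}) (at_right x)"
        by (rule eventually_at_right_real)
      then have "eventually (\<lambda>y. g y = g x) (at_right x)"
      proof eventually_elim
        case (elim y)
        have "x / h < y / h" "y / h < real_of_int \<lfloor>x / h\<rfloor> + 1"
          using elim h by (auto simp: u_def field_simps)
        then have "\<lfloor>y / h\<rfloor> = \<lfloor>x / h\<rfloor>" by linarith
        then show ?case by (simp add: g_def)
      qed
      then show ?thesis
        unfolding continuous_within by (rule tendsto_eventually)
    qed
    fix N :: nat assume N: "1 \<le> N"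
    have *: "((\<lambda>s. g (real N * h - s) * \<psi> s) has_integral (\<Sum>k<m. step h k * b (N - 1 - k))) {0..real m * h}"
      if "m \<le> N" for m
      using that
    proof (induction m)
      case (Suc m)
      have "((\<lambda>s. g (real N * h - s) * \<psi> s) has_integral b (N - 1 - m) * step h m) {real m * h..real (Suc m) * h}"
      \<comment> \<open>Inside the m-th cell the reflected point lies in cell N - 1 - m. At the left
        end point the index would be N - m, so the end points are left out.\<close>
      proof (rule has_integral_spike_finite[OF _ _ has_integral_mult_right[OF step_has_integral[OF h]]])
        show "finite {real m * h, real (Suc m) * h}" by simp
        fix s assume s: "s \<in> {real m * h..real (Suc m) * h} - {real m * h, real (Suc m) * h}"
        have "\<lfloor>(real N * h - s) / h\<rfloor> = int (N - 1 - m)"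
        proof (rule floor_unique)
          have "real (N - 1 - m) = real N - 1 - real m" using Suc by linarith
          then show "real_of_int (int (N - 1 - m)) \<le> (real N * h - s) / h"
            "(real N * h - s) / h < real_of_int (int (N - 1 - m)) + 1"
            using s h by (auto simp: field_simps)
        qed
        then show "g (real N * h - s) * \<psi> s = b (N - 1 - m) * \<psi> s" by (simp add: g_def)
      qed
      from has_integral_combine[OF _ _ Suc.IH this] Suc.prems h
      show ?case by (simp add: mult.commute algebra_simps)
    qed (use has_integral_refl(2)[of _ "0::real"] in simp)
    have "(\<Sum>k<N. step h k * b (N - 1 - k)) = 1"
      using b(3)[of "N - 1"] N by (simp add: lessThan_Suc_atMost[symmetric])
    with *[of N] show "((\<lambda>s. g (real N * h - s) * \<psi> s) has_integral 1) {0..real N * h}" by simp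
  qed
qed

end

section \<open>Reflections, monotone functions and their limits\<close>

lemma has_integral_reflect_shift:
  fixes f :: "real \<Rightarrow> real"
  assumes "(f has_integral I) {a..b}"
  shows "((\<lambda>s. f (T - s)) has_integral I) {T - b..T - a}"
proof -
  have "((\<lambda>x. f (- x)) has_integral I) {-b..-a}"
    using assms by simp
  from has_integral_affinity'[OF this[folded cbox_interval], of 1 "- T"]
  show ?thesis by (simp add: algebra_simps)
qed

lemma antimono_integrable_on:
  fixes f :: "real \<Rightarrow> real"
  assumes "antimono f"
  shows "f integrable_on {a..b}"
proof -
  have "mono_on {a..b} (\<lambda>x. - f x)"
    using assms by (auto simp: monotone_on_def)
  from integrable_neg[OF integrable_on_mono_on[OF this]] show ?thesis by simp
qed

text \<open>Helly's theorem asks for uniformly bounded nondecreasing functions, while the step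
  functions are nonincreasing and have no common bound near 0. This transformation maps them into
  the unit interval.\<close>

lemma mono_one_divide_one_plus:
  fixes g :: "real \<Rightarrow> real"
  assumes "antimono g" "\<And>x. 0 \<le> g x"
  shows "mono (\<lambda>x. 1 / (1 + g x))"
proof (rule monoI)
  fix x y :: real assume "x \<le> y"
  then show "1 / (1 + g x) \<le> 1 / (1 + g y)"
    using antimonoD[OF assms(1), of x y] assms(2)[of x] assms(2)[of y]
    by (intro divide_left_mono) (auto intro!: mult_pos_pos)
qed

text \<open>A monotone function has only countably many discontinuities, too few to fill an
  interval.\<close>

lemma continuity_point_between:
  fixes F :: "real \<Rightarrow> real"
  assumes "mono F" "a < b"
  obtains c where "a < c" "c < b" "isCont F c"
proof -
  have "\<not> {a<..<b} \<subseteq> {x. \<not> isCont F x}"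
    using countable_subset[OF _ mono_ctble_discont[OF assms(1)]] uncountable_open_interval[of a b] assms
    by blast
  then show ?thesis using that by auto
qed

text \<open>The moving argument is trapped between continuity points of F on either side of x, and
  monotonicity transfers the limits there. This is needed because the convolution is controlled at
  grid points converging to t, not at t itself.\<close>

lemma mono_converges_along:
  fixes f :: "nat \<Rightarrow> real \<Rightarrow> real"
  assumes mono: "\<And>k. mono (f k)" and F: "mono F"
    and lim: "\<And>x. isCont F x \<Longrightarrow> (\<lambda>k. f k x) \<longlonglongrightarrow> F x"
    and x: "isCont F x" and u: "u \<longlonglongrightarrow> x"
  shows "(\<lambda>k. f k (u k)) \<longlonglongrightarrow> F x"
proof (rule order_tendstoI)
  fix a assume a: "a < F x"
  then have "eventually (\<lambda>y. a < F y) (at x)"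
    using x by (auto simp: isCont_def intro: order_tendstoD)
  then have "eventually (\<lambda>y. a < F y) (at_left x)"
    by (simp add: eventually_at_split)
  then obtain d where d: "d < x" "\<And>y. d < y \<Longrightarrow> y < x \<Longrightarrow> a < F y"
    by (auto simp: eventually_at_left_field)
  obtain y where y: "d < y" "y < x" "isCont F y"
    using continuity_point_between[OF F d(1)] .
  have "eventually (\<lambda>k. a < f k y) sequentially"
    using lim[OF y(3)] d(2)[OF y(1,2)] by (rule order_tendstoD)
  moreover have "eventually (\<lambda>k. y < u k) sequentially"
    using u y(2) by (rule order_tendstoD)
  ultimately show "eventually (\<lambda>k. a < f k (u k)) sequentially"
  proof eventually_elim
    case (elim k)
    then show ?case using monoD[OF mono, of y "u k" k] by linarith
  qed
next
  fix a assume a: "a > F x"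
  then have "eventually (\<lambda>y. a > F y) (at x)"
    using x by (auto simp: isCont_def intro: order_tendstoD)
  then have "eventually (\<lambda>y. a > F y) (at_right x)"
    by (simp add: eventually_at_split)
  then obtain d where d: "d > x" "\<And>y. x < y \<Longrightarrow> y < d \<Longrightarrow> a > F y"
    by (auto simp: eventually_at_right_field)
  obtain y where y: "x < y" "y < d" "isCont F y"
    using continuity_point_between[OF F d(1)] .
  have "eventually (\<lambda>k. a > f k y) sequentially"
    using lim[OF y(3)] d(2)[OF y(1,2)] by (rule order_tendstoD)
  moreover have "eventually (\<lambda>k. y > u k) sequentially"
    using u y(1) by (rule order_tendstoD)
  ultimately show "eventually (\<lambda>k. a > f k (u k)) sequentially"
  proof eventually_elim
    case (elim k)
    then show ?case using monoD[OF mono, of "u k" y k] by linarith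
  qed
qed

lemma grid_ceiling:
  fixes h t :: real
  assumes "0 < h" "0 < t"
  obtains N :: nat where "1 \<le> N" "t \<le> real N * h" "real N * h < t + h"
proof
  have "0 < t / h" using assms by simp
  then have c: "real (nat \<lceil>t / h\<rceil>) = of_int \<lceil>t / h\<rceil>" and "1 \<le> \<lceil>t / h\<rceil>"
    by linarith+
  then show "1 \<le> nat \<lceil>t / h\<rceil>" by linarith
  have "t / h \<le> real (nat \<lceil>t / h\<rceil>)"
    unfolding c by linarith
  then show "t \<le> real (nat \<lceil>t / h\<rceil>) * h"
    unfolding pos_divide_le_eq[OF assms(1)] .
  have "real (nat \<lceil>t / h\<rceil>) < (t + h) / h"
    unfolding c add_divide_distrib using assms by simp linarith
  then show "real (nat \<lceil>t / h\<rceil>) * h < t + h"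
    using assms by (simp add: pos_less_divide_eq)
qed

section \<open>Bounds on the step functions uniform in the grid width\<close>

context log_convex_kernel
begin

text \<open>The first grid point at or above x is below 2 * x, because h is at most x. On the
  interval up to it \<psi> is at least \<psi> (2 * x), so the convolution identity bounds the mass
  of g; monotonicity then bounds g x. As \<psi> is unbounded at 0, the first bound shows that no
  mass accumulates there.\<close>

lemma grid_inverse_bounds:
  assumes h: "0 < h" "h \<le> x"
    and g: "\<And>x. 0 \<le> g x" "antimono g"
      "\<And>N. 1 \<le> N \<Longrightarrow> ((\<lambda>s. g (real N * h - s) * \<psi> s) has_integral 1) {0..real N * h}"
  shows "integral {0..x} g \<le> 1 / \<psi> (2 * x)" "g x \<le> 1 / (x * \<psi> (2 * x))"
proof -
  have x: "x > 0" using h by simp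
  have int: "g integrable_on {a..b}" for a b using g(2) by (rule antimono_integrable_on)
  obtain N where N: "1 \<le> N" "x \<le> real N * h" "real N * h < x + h"
    using grid_ceiling[OF h(1) x] .
  define I where "I = integral {0..real N * h} g"
  have I: "((\<lambda>s. g (real N * h - s)) has_integral I) {0..real N * h}"
    using has_integral_reflect_shift[OF integrable_integral[OF int], of "real N * h" 0 "real N * h"]
    by (simp add: I_def)
  have "I * \<psi> (2 * x) \<le> 1"
  proof (rule has_integral_le[OF has_integral_spike_finite[OF _ _ has_integral_mult_left[OF I], of "{0}"]
        has_integral_spike_finite[OF _ _ g(3)[OF N(1)], of "{0}"]])
    fix s assume s: "s \<in> {0..real N * h}"
    show "(if s = 0 then 0 else g (real N * h - s) * \<psi> (2 * x)) \<le>
      (if s = 0 then 0 else g (real N * h - s) * \<psi> s)"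
      using s N h by (auto intro!: mult_left_mono antimono g)
  qed auto
  moreover have "integral {0..x} g \<le> I"
    unfolding I_def using N g(1) int by (intro integral_subset_le) auto
  moreover have p: "0 < \<psi> (2 * x)" using x by (intro pos) simp
  ultimately have "integral {0..x} g * \<psi> (2 * x) \<le> 1"
    by (meson less_imp_le mult_right_mono order_trans)
  with p show 1: "integral {0..x} g \<le> 1 / \<psi> (2 * x)" by (simp add: field_simps)
  have "((\<lambda>_. g x) has_integral x * g x) {0..x}"
    using has_integral_const_real[of "g x" 0 x] x by simp
  then have "x * g x \<le> integral {0..x} g"
    by (rule has_integral_le[OF _ integrable_integral[OF int]]) (auto intro!: antimonoD[OF g(2)])
  with 1 have "x * g x \<le> 1 / \<psi> (2 * x)" by simp
  with x p show "g x \<le> 1 / (x * \<psi> (2 * x))" by (simp add: field_simps)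
qed

end

text \<open>Signs are asked for in the open interval only, since the kernels may have meaningless
  values at the end points.\<close>

lemma absolutely_integrable_on_Ioo_nonneg:
  fixes f :: "real \<Rightarrow> real"
  assumes "(f has_integral I) {a..b}" "\<And>x. a < x \<Longrightarrow> x < b \<Longrightarrow> 0 \<le> f x"
  shows "f absolutely_integrable_on {a..b}"
proof -
  have "f integrable_on {a<..<b}"
    using assms(1) by (auto simp: has_integral_Icc_iff_Ioo integrable_on_def)
  then show ?thesis
    unfolding absolutely_integrable_on_Icc_iff_Ioo
    by (rule nonnegative_absolutely_integrable_1) (use assms(2) in auto)
qed

section \<open>Passage to the limit: existence of the partner kernel\<close>

context log_convex_kernel
begin

text \<open>The convolution identity survives the limit in two stages: dominated convergence on
  {0..t - e}, with the remainder controlled by \<psi> (t / 2) / \<psi> (4 * e), and then monotone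
  convergence as e tends to 0.\<close>

theorem ex_PC: "\<exists>\<phi>. PC \<phi> \<psi>"
proof -
  define h where "h m = 1 / real (Suc m)" for m
  have "\<forall>m. \<exists>g. (\<forall>x. 0 \<le> g x) \<and> antimono g \<and> (\<forall>x. continuous (at_right x) g) \<and>
    (\<forall>N\<ge>1. ((\<lambda>s. g (real N * h m - s) * \<psi> s) has_integral 1) {0..real N * h m})"
  proof
    fix m
    have "0 < h m" by (simp add: h_def)
    from grid_inverse[OF this] show "\<exists>g. (\<forall>x. 0 \<le> g x) \<and> antimono g \<and> (\<forall>x. continuous (at_right x) g) \<and>
      (\<forall>N\<ge>1. ((\<lambda>s. g (real N * h m - s) * \<psi> s) has_integral 1) {0..real N * h m})"
      by metis
  qed
  then obtain g where g: "\<And>m x. 0 \<le> g m x" "\<And>m. antimono (g m)" "\<And>m x. continuous (at_right x) (g m)"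
    "\<And>m N. 1 \<le> N \<Longrightarrow> ((\<lambda>s. g m (real N * h m - s) * \<psi> s) has_integral 1) {0..real N * h m}"
    by (subst (asm) choice_iff) blast
  have g1: "1 + g m x \<noteq> 0" for m x using g(1)[of m x] by linarith

  have "\<exists>r. strict_mono (r::nat \<Rightarrow> nat) \<and> (\<exists>F. (\<forall>x. continuous (at_right x) F) \<and> mono F \<and> (\<forall>x. \<bar>F x\<bar> \<le> 1) \<and>
    (\<forall>x. continuous (at x) F \<longrightarrow> (\<lambda>n. 1 / (1 + g (r n) x)) \<longlonglongrightarrow> F x))"
  proof (rule Helly_selection)
    show "continuous (at_right x) (\<lambda>x. 1 / (1 + g n x))" for n x
      using g1 g(3) unfolding continuous_within by (intro tendsto_intros) auto
    show "mono (\<lambda>x. 1 / (1 + g n x))" for n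
      using g(2,1) by (rule mono_one_divide_one_plus)
    show "\<bar>1 / (1 + g n x)\<bar> \<le> 1" for n x
      using g(1)[of n x] by (simp add: field_simps)
  qed
  then obtain r F where r: "strict_mono (r :: nat \<Rightarrow> nat)" and F: "mono F" "\<And>x. \<bar>F x\<bar> \<le> 1"
    and lim: "\<And>x. isCont F x \<Longrightarrow> (\<lambda>n. 1 / (1 + g (r n) x)) \<longlonglongrightarrow> F x"
    by auto
  define G H where "G n = g (r n)" and "H n = h (r n)" for n
  have G: "0 \<le> G n x" "antimono (G n)"
    "1 \<le> N \<Longrightarrow> ((\<lambda>s. G n (real N * H n - s) * \<psi> s) has_integral 1) {0..real N * H n}" for n x N
    using g by (auto simp: G_def H_def)
  have Hpos: "0 < H n" for n by (simp add: H_def h_def)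
  have "h \<longlonglongrightarrow> 0" unfolding h_def using LIMSEQ_inverse_real_of_nat by (simp add: inverse_eq_divide)
  then have H0: "H \<longlonglongrightarrow> 0"
    using LIMSEQ_subseq_LIMSEQ[OF _ r] by (simp add: H_def[abs_def] o_def)
  have Gint: "G n integrable_on {a..b}" for n a b
    using G(2) by (rule antimono_integrable_on)
  have GF: "(\<lambda>n. 1 / (1 + G n x)) \<longlonglongrightarrow> F x" if "isCont F x" for x
    using lim[OF that] by (simp add: G_def)

  \<comment> \<open>Positivity of F means that the step functions do not blow up away from 0; it
    comes from their uniform bound at a continuity point below x.\<close>
  have Fpos: "0 < F x" if x: "0 < x" for x
  proof -
    obtain c where c: "0 < c" "c < x" "isCont F c"
      using continuity_point_between[OF F(1) x] .
    define C where "C = 1 / (c * \<psi> (2 * c))"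
    have C: "C > 0" using c by (auto simp: C_def intro!: divide_pos_pos mult_pos_pos pos)
    have "eventually (\<lambda>n. H n < c) sequentially"
      using H0 c(1) by (rule order_tendstoD)
    then have "eventually (\<lambda>n. 1 / (1 + C) \<le> 1 / (1 + G n c)) sequentially"
    proof eventually_elim
      case (elim n)
      then have "G n c \<le> C"
        unfolding C_def using grid_inverse_bounds(2)[OF Hpos _ G] by auto
      then show ?case using G(1)[of n c] C by (intro divide_left_mono) (auto intro!: mult_pos_pos)
    qed
    then have "1 / (1 + C) \<le> F c"
      using GF[OF c(3)] by (metis tendsto_lowerbound trivial_limit_sequentially)
    moreover have "0 < 1 / (1 + C)" using C by simp
    ultimately show ?thesis using monoD[OF F(1), of c x] c by linarith
  qed
  \<comment> \<open>This undoes the transformation of g into 1 / (1 + g).\<close>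
  define \<phi> where "\<phi> x = 1 / F x - 1" for x
  have \<phi>_nonneg: "0 \<le> \<phi> x" if "0 < x" for x
    using F(2)[of x] Fpos[OF that] by (simp add: \<phi>_def field_simps)
  have \<phi>_antimono: "antimono_on {0<..} \<phi>"
  proof (rule monotone_onI)
    fix x y :: real assume "x \<in> {0<..}" "y \<in> {0<..}" "x \<le> y"
    then show "\<phi> x \<ge> \<phi> y"
      using Fpos[of x] Fpos[of y] monoD[OF F(1), of x y]
      by (simp add: \<phi>_def divide_left_mono)
  qed
  have \<phi>_meas: "\<phi> \<in> borel_measurable borel"
    unfolding \<phi>_def using borel_measurable_mono[OF F(1)] by measurable
  have along: "(\<lambda>n. G n (u n)) \<longlonglongrightarrow> \<phi> x" if "0 < x" "isCont F x" "u \<longlonglongrightarrow> x" for u x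
  proof -
    have "(\<lambda>n. 1 / (1 + G n (u n))) \<longlonglongrightarrow> F x"
    proof (rule mono_converges_along[where f = "\<lambda>n x. 1 / (1 + G n x)", OF _ F(1) GF that(2,3)])
      show "mono (\<lambda>x. 1 / (1 + G n x))" for n
        using G(2,1) by (rule mono_one_divide_one_plus)
    qed
    then have "(\<lambda>n. 1 / (1 / (1 + G n (u n))) - 1) \<longlonglongrightarrow> 1 / F x - 1"
      using Fpos[OF that(1)] by (intro tendsto_intros) auto
    then show ?thesis by (simp add: \<phi>_def)
  qed

  have conv: "((\<lambda>s. \<phi> (t - s) * \<psi> s) has_integral 1) {0..t}" if t: "0 < t" for t
  proof -
    \<comment> \<open>The identity is available at grid points only, so t is replaced by the first
      grid point T n at or above it.\<close>
    have "\<forall>n. \<exists>N. 1 \<le> N \<and> t \<le> real N * H n \<and> real N * H n < t + H n"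
      using grid_ceiling[OF Hpos t] by metis
    then obtain N where N: "\<And>n. 1 \<le> N n" "\<And>n. t \<le> real (N n) * H n" "\<And>n. real (N n) * H n < t + H n"
      by metis
    define T where "T n = real (N n) * H n" for n
    have T: "t \<le> T n" "T n < t + H n" and
      one: "((\<lambda>s. G n (T n - s) * \<psi> s) has_integral 1) {0..T n}" for n
      using N G(3) by (auto simp: T_def)
    have Tt: "T \<longlonglongrightarrow> t"
    proof (rule tendsto_sandwich[of "\<lambda>_. t"])
      show "(\<lambda>n. t + H n) \<longlonglongrightarrow> t" using tendsto_add[OF tendsto_const H0, of t] by simp
    qed (use T in \<open>auto intro!: always_eventually simp: less_imp_le\<close>)
    define J where "J e = integral {0..t - e} (\<lambda>s. \<phi> (t - s) * \<psi> s)" for e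
    have J: "(\<lambda>s. \<phi> (t - s) * \<psi> s) integrable_on {0..t - e}" "J e \<le> 1" "1 - \<psi> (t / 2) / \<psi> (4 * e) \<le> J e"
      if e: "0 < e" "e \<le> t / 2" for e
    proof -
      have "eventually (\<lambda>n. H n < e) sequentially"
        using H0 e(1) by (rule order_tendstoD)
      then obtain K where K: "\<And>n. H (n + K) \<le> e"
        unfolding eventually_sequentially by (metis le_add2 less_imp_le)
      \<comment> \<open>Outside this countable set the integrands converge: it collects the s for
        which F is discontinuous at t - s, and the point 0, where \<psi> is uncontrolled.\<close>
      define D where "D = insert 0 ((\<lambda>x. t - x) ` {x. \<not> isCont F x})"
      have "countable D" unfolding D_def using mono_ctble_discont[OF F(1)] by simp
      then have D: "negligible D" by (simp add: negligible_iff_null_sets countable_imp_null_set_lborel null_sets_completionI)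
      have inc: "((\<lambda>s. G n (T n - s) * \<psi> s) integrable_on {a..b})" if "0 \<le> a" "b \<le> T n" for n a b
        using integrable_subinterval_real[OF has_integral_integrable[OF one]] that by auto
      \<comment> \<open>For s up to t - e the argument T - s is at least e, so C bounds the step
        functions there once the width is at most e. The shift by K ensures this width.\<close>
      define C where "C = 1 / (e * \<psi> (2 * e))"
      define k where "k n = integral {0..t - e} (\<lambda>s. G (n + K) (T (n + K) - s) * \<psi> s)" for n
      let ?q = "\<lambda>n s. if s \<in> D then 0 else G (n + K) (T (n + K) - s) * \<psi> s"
      have q: "(?q n has_integral k n) {0..t - e}" for n
      proof (rule has_integral_spike[OF D])
        show "((\<lambda>s. G (n + K) (T (n + K) - s) * \<psi> s) has_integral k n) {0..t - e}"
          unfolding k_def using e T[of "n + K"] by (intro integrable_integral inc) auto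
      qed auto
      have b: "norm (?q n s) \<le> (if s \<in> D then 0 else C * \<psi> s)" if "s \<in> {0..t - e}" for n s
      proof (cases "s \<in> D")
        case False
        then have "s > 0" using that by (auto simp: D_def)
        have "G (n + K) (T (n + K) - s) \<le> G (n + K) e"
          using that T[of "n + K"] by (intro antimonoD[OF G(2)]) auto
        also have "\<dots> \<le> C" unfolding C_def by (rule grid_inverse_bounds(2)[OF Hpos K G])
        finally show ?thesis using False G(1) pos[OF \<open>s > 0\<close>]
          by (simp add: abs_mult mult_right_mono)
      qed simp
      have "(\<lambda>s. C * \<psi> s) integrable_on {0..t - e}"
        by (intro integrable_on_mult_right integrable) simp
      then have bi: "(\<lambda>s. if s \<in> D then 0 else C * \<psi> s) integrable_on {0..t - e}"
        by (rule integrable_spike[OF _ D]) simp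
      have l: "(\<lambda>n. ?q n s) \<longlonglongrightarrow> (if s \<in> D then 0 else \<phi> (t - s) * \<psi> s)" if s: "s \<in> {0..t - e}" for s
      proof (cases "s \<in> D")
        case False
        then have c: "isCont F (t - s)" by (auto simp: D_def image_iff)
        have "(\<lambda>n. G n (T n - s)) \<longlonglongrightarrow> \<phi> (t - s)"
          using s e by (intro along c tendsto_intros Tt) auto
        then have "(\<lambda>n. G (n + K) (T (n + K) - s)) \<longlonglongrightarrow> \<phi> (t - s)"
          by (rule LIMSEQ_ignore_initial_segment)
        then show ?thesis using False by (auto intro!: tendsto_intros)
      qed simp
      note dc = dominated_convergence[OF has_integral_integrable[OF q] bi b l]
      have *: "((\<lambda>s. \<phi> (t - s) * \<psi> s) has_integral integral {0..t - e} (\<lambda>s. if s \<in> D then 0 else \<phi> (t - s) * \<psi> s)) {0..t - e}"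
        by (rule has_integral_spike[OF D _ integrable_integral[OF dc(1)]]) auto
      then show "(\<lambda>s. \<phi> (t - s) * \<psi> s) integrable_on {0..t - e}" by blast
      have kJ: "k \<longlonglongrightarrow> J e"
        using dc(2) q integral_unique[OF *] by (simp add: J_def integral_unique[OF q])
      have k: "k n \<le> 1" "1 - \<psi> (t / 2) / \<psi> (4 * e) \<le> k n" for n
      proof -
        let ?n = "n + K"
        \<comment> \<open>R is the part of the convolution beyond t - e. There \<psi> is at most
          \<psi> (t / 2), and the reflected interval has length at most 2 * e, so the step function
          has mass at most 1 / \<psi> (4 * e) on it.\<close>
        define R where "R = integral {t - e..T ?n} (\<lambda>s. G ?n (T ?n - s) * \<psi> s)"
        have R: "((\<lambda>s. G ?n (T ?n - s) * \<psi> s) has_integral R) {t - e..T ?n}"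
          unfolding R_def using e by (intro integrable_integral inc) auto
        have "((\<lambda>s. G ?n (T ?n - s) * \<psi> s) has_integral k n) {0..t - e}"
          unfolding k_def using e T[of ?n] by (intro integrable_integral inc) auto
        from has_integral_combine[OF _ _ this R] have sum: "k n + R = 1"
          using has_integral_unique[OF _ one] e T[of ?n] by auto
        have "0 \<le> R"
          using e by (intro has_integral_nonneg[OF R] mult_nonneg_nonneg G(1) less_imp_le pos) auto
        with sum show "k n \<le> 1" by simp
        define I where "I = integral {0..T ?n - t + e} (G ?n)"
        have "(G ?n has_integral I) {0..T ?n - t + e}"
          unfolding I_def by (intro integrable_integral Gint)
        from has_integral_reflect_shift[OF this, of "T ?n"]
        have I: "((\<lambda>s. G ?n (T ?n - s)) has_integral I) {t - e..T ?n}" by simp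
        have "R \<le> I * \<psi> (t / 2)"
          using e t by (intro has_integral_le[OF R has_integral_mult_left[OF I]] mult_left_mono antimono G(1)) auto
        also have "I \<le> integral {0..2 * e} (G ?n)"
          unfolding I_def using T[of ?n] K[of n] e by (intro integral_subset_le Gint) (auto simp: G(1))
        also have "\<dots> \<le> 1 / \<psi> (2 * (2 * e))"
          using K[of n] e by (intro grid_inverse_bounds(1)[OF Hpos _ G]) auto
        finally have "R \<le> 1 / \<psi> (2 * (2 * e)) * \<psi> (t / 2)"
          using pos[of "t / 2"] t by (simp add: mult_right_mono)
        with sum show "1 - \<psi> (t / 2) / \<psi> (4 * e) \<le> k n" by simp
      qed
      show "J e \<le> 1" "1 - \<psi> (t / 2) / \<psi> (4 * e) \<le> J e"
        using k by (auto intro: LIMSEQ_le_const2[OF kJ] LIMSEQ_le_const[OF kJ])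
    qed

    define e where "e j = t / 2 * (1 / real (Suc j))" for j
    have e: "0 < e j" "e j \<le> t / 2" for j using t by (auto simp: e_def field_simps)
    have edec: "e (Suc j) \<le> e j" for j unfolding e_def using t by (intro mult_left_mono divide_left_mono) auto
    have e0: "e \<longlonglongrightarrow> 0"
      using tendsto_mult[OF tendsto_const LIMSEQ_inverse_real_of_nat, of "t / 2"] by (simp add: e_def[abs_def] inverse_eq_divide)
    \<comment> \<open>Unboundedness of \<psi> at 0 enters here: it makes the error term
      vanish.\<close>
    have Je: "(\<lambda>j. J (e j)) \<longlonglongrightarrow> 1"
    proof (rule tendsto_sandwich)
      have "filterlim (\<lambda>j. 4 * e j) (at_right 0) sequentially"
        unfolding filterlim_at using e tendsto_mult[OF tendsto_const e0, of 4] by (auto simp: less_imp_le less_imp_neq[symmetric])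
      then have "filterlim (\<lambda>j. \<psi> (4 * e j)) at_top sequentially"
        by (rule filterlim_compose[OF unbounded])
      from tendsto_divide_0[OF tendsto_const filterlim_at_top_imp_at_infinity[OF this], of "\<psi> (t / 2)"]
      show "(\<lambda>j. 1 - \<psi> (t / 2) / \<psi> (4 * e j)) \<longlonglongrightarrow> 1"
        using tendsto_diff[OF tendsto_const, of _ 0 sequentially "1::real"] by simp
    qed (use J[OF e] in auto)
    have nn: "0 \<le> \<phi> (t - s) * \<psi> s" if "0 < s" "s < t" for s
      using that by (intro mult_nonneg_nonneg \<phi>_nonneg less_imp_le[OF pos]) auto
    have "((\<lambda>s. \<phi> (t - s) * \<psi> s) has_integral 1) {0<..<t}"
    proof (rule has_integral_monotone_convergence_increasing[OF _ _ _ Je])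
      fix j
      let ?f = "\<lambda>s. if s \<in> {0..t - e j} then \<phi> (t - s) * \<psi> s else 0"
      have "(?f has_integral J (e j)) {0..t - e j}"
        by (rule has_integral_eq[OF _ integrable_integral[OF J(1)[OF e], folded J_def]]) simp
      then have "(?f has_integral J (e j)) {0..t}"
        by (rule has_integral_on_superset) (use e[of j] in auto)
      then show "(?f has_integral J (e j)) {0<..<t}" by (simp add: has_integral_Icc_iff_Ioo)
      fix s assume "s \<in> {0<..<t}"
      then show "?f s \<le> (if s \<in> {0..t - e (Suc j)} then \<phi> (t - s) * \<psi> s else 0)"
        using nn[of s] edec[of j] by auto
    next
      fix s assume s: "s \<in> {0<..<t}"
      then have "eventually (\<lambda>j. e j < t - s) sequentially"
        by (intro order_tendstoD[OF e0]) auto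
      then have "eventually (\<lambda>j. (if s \<in> {0..t - e j} then \<phi> (t - s) * \<psi> s else 0) = \<phi> (t - s) * \<psi> s) sequentially"
        by eventually_elim (use s in auto)
      then show "(\<lambda>j. if s \<in> {0..t - e j} then \<phi> (t - s) * \<psi> s else 0) \<longlonglongrightarrow> \<phi> (t - s) * \<psi> s"
        by (rule tendsto_eventually)
    qed
    then show ?thesis by (simp add: has_integral_Icc_iff_Ioo)
  qed

  have "convolution \<phi> \<psi> t = 1" if t: "0 < t" for t
  proof -
    have "(\<lambda>s. \<phi> (t - s) * \<psi> s) absolutely_integrable_on {0..t}"
      by (intro absolutely_integrable_on_Ioo_nonneg[OF conv[OF t]] mult_nonneg_nonneg \<phi>_nonneg less_imp_le[OF pos]) auto
    from set_lebesgue_integral_eq_integral(2)[OF this] integral_unique[OF conv[OF t]]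
    show ?thesis by (simp add: convolution_def)
  qed
  moreover have "L1_loc \<phi>"
    unfolding L1_loc_def
  proof (intro allI impI)
    fix T :: real assume T: "0 < T"
    \<comment> \<open>Since \<psi> is at least \<psi> T on this interval, the convolution integrand
      divided by \<psi> T dominates the reflected \<phi>.\<close>
    have "(\<lambda>s. \<phi> (T - s)) integrable_on {0<..<T}"
    proof (rule measurable_bounded_by_integrable_imp_integrable)
      have "(\<lambda>s. \<phi> (T - s)) \<in> borel_measurable borel" using \<phi>_meas by measurable
      then show "(\<lambda>s. \<phi> (T - s)) \<in> borel_measurable (lebesgue_on {0<..<T})"
        by (simp add: measurable_completion measurable_restrict_space1)
      have "(\<lambda>s. \<phi> (T - s) * \<psi> s) integrable_on {0<..<T}"
        using conv[OF T] by (auto simp: has_integral_Icc_iff_Ioo integrable_on_def)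
      then show "(\<lambda>s. \<phi> (T - s) * \<psi> s * (1 / \<psi> T)) integrable_on {0<..<T}"
        by (rule integrable_on_mult_left)
      fix s assume s: "s \<in> {0<..<T}"
      have "\<phi> (T - s) * \<psi> T \<le> \<phi> (T - s) * \<psi> s"
        using s by (intro mult_left_mono antimono \<phi>_nonneg) auto
      then show "norm (\<phi> (T - s)) \<le> \<phi> (T - s) * \<psi> s * (1 / \<psi> T)"
        using s pos[OF T] \<phi>_nonneg[of "T - s"] by (simp add: field_simps)
    qed simp
    then obtain I where "((\<lambda>s. \<phi> (T - s)) has_integral I) {0..T}"
      by (auto simp: has_integral_Icc_iff_Ioo integrable_on_def)
    from has_integral_reflect_shift[OF this, of T] have "(\<phi> has_integral I) {0..T}" by simp
    then show "\<phi> absolutely_integrable_on {0..T}"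
      by (rule absolutely_integrable_on_Ioo_nonneg) (rule \<phi>_nonneg)
  qed
  moreover have "L1_loc \<psi>"
    unfolding L1_loc_def
    using absolutely_integrable_on_Ioo_nonneg[OF integrable_integral[OF integrable[of 0]]] less_imp_le[OF pos] by auto
  ultimately have "PC \<phi> \<psi>"
    using \<phi>_nonneg \<phi>_antimono unfolding PC_def by blast
  then show ?thesis by blast
qed

end

section \<open>The kernel with logarithmic asymptotics\<close>

definition Lam :: "real \<Rightarrow> real" where
  "Lam t = (1 + t) * ln (1 + t) - t * ln t"

text \<open>For t > 0 this is ln (1 + 1 / t), the derivative of \<open>Lam\<close>. The capital
  letter denotes the primitive, as with \<open>Psi\<close> and \<open>psi\<close> below.\<close>

definition lam :: "real \<Rightarrow> real" where
  "lam t = ln (1 + t) - ln t"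

lemma Lam_alt: "Lam t = ln (1 + t) + t * lam t"
  by (simp add: Lam_def lam_def algebra_simps)

lemma Lam_0 [simp]: "Lam 0 = 0"
  by (simp add: Lam_def)

lemma Lam_measurable [measurable]: "Lam \<in> borel_measurable borel"
  unfolding Lam_def by measurable

lemma DERIV_lam: "0 < t \<Longrightarrow> (lam has_real_derivative - 1 / (t * (1 + t))) (at t)"
  unfolding lam_def by (auto intro!: derivative_eq_intros simp: field_simps)

lemma DERIV_Lam: "0 < t \<Longrightarrow> (Lam has_real_derivative lam t) (at t)"
  unfolding Lam_def lam_def by (auto intro!: derivative_eq_intros simp: field_simps)

lemma DERIV_Lam_scaled:
  "0 < c * t \<Longrightarrow> ((\<lambda>t. Lam (c * t)) has_real_derivative lam (c * t) * c) (at t)"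
  by (rule DERIV_chain2[where f = Lam and g = "\<lambda>t. c * t"]) (auto intro!: DERIV_Lam derivative_eq_intros)

lemma DERIV_lam_scaled:
  "0 < c * t \<Longrightarrow> ((\<lambda>t. lam (c * t)) has_real_derivative - 1 / (c * t * (1 + c * t)) * c) (at t)"
  by (rule DERIV_chain2[where f = lam and g = "\<lambda>t. c * t", OF DERIV_lam]) (auto intro!: derivative_eq_intros)

lemma lam_ge: "0 < t \<Longrightarrow> 1 / (1 + t) \<le> lam t"
  using ln_le_minus_one[of "t / (1 + t)"] by (simp add: lam_def ln_div field_simps)

lemma lam_pos: "0 < t \<Longrightarrow> 0 < lam t"
  using lam_ge[of t] by (smt (verit) divide_pos_pos)

lemma Lam_pos: "0 < t \<Longrightarrow> 0 < Lam t"
  unfolding Lam_alt using lam_pos[of t] by (simp add: add_pos_pos)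

lemma Lam_nonneg: "0 \<le> t \<Longrightarrow> 0 \<le> Lam t"
  using Lam_pos[of t] by (cases "t = 0") auto

lemma lam_antimono:
  assumes "0 < s" "s \<le> t"
  shows "lam t \<le> lam s"
proof (rule DERIV_nonpos_imp_nonincreasing[OF assms(2)])
  fix x assume "s \<le> x"
  then have x: "0 < x" using assms by simp
  then have "- 1 / (x * (1 + x)) \<le> 0" by simp
  with DERIV_lam[OF x] show "\<exists>y. (lam has_real_derivative y) (at x) \<and> y \<le> 0" by blast
qed

lemma Lam_mono:
  assumes "0 < s" "s \<le> t"
  shows "Lam s \<le> Lam t"
proof (rule DERIV_nonneg_imp_nondecreasing[OF assms(2)])
  fix x assume "s \<le> x"
  then have "0 < x" using assms by simp
  then show "\<exists>y. (Lam has_real_derivative y) (at x) \<and> 0 \<le> y"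
    using DERIV_Lam lam_pos less_imp_le by blast
qed

text \<open>The numerator of the derivative is t * lam t - Lam t = - ln (1 + t).\<close>

lemma Lam_div_antimono:
  assumes "0 < s" "s \<le> t"
  shows "Lam t / t \<le> Lam s / s"
proof (rule DERIV_nonpos_imp_nonincreasing[OF assms(2)])
  fix x assume "s \<le> x"
  then have x: "0 < x" using assms by simp
  have "((\<lambda>t. Lam t / t) has_real_derivative (lam x * x - Lam x * 1) / (x * x)) (at x)"
    using x by (intro DERIV_divide DERIV_Lam DERIV_ident) auto
  moreover have "(lam x * x - Lam x * 1) / (x * x) \<le> 0"
    using x by (simp add: Lam_alt divide_nonpos_pos)
  ultimately show "\<exists>y. ((\<lambda>t. Lam t / t) has_real_derivative y) (at x) \<and> y \<le> 0" by blast
qed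

text \<open>Monotonicity of \<open>Lam\<close> covers u at most 1, and that of Lam t / t covers u >
  1. The linear growth in u supplies the majorant for dominated convergence.\<close>

lemma Lam_mult_le:
  assumes "0 < u" "0 < t"
  shows "Lam (u * t) \<le> (1 + u) * Lam t"
proof (cases "u \<le> 1")
  case True
  then have "Lam (u * t) \<le> 1 * Lam t"
    using assms Lam_mono[of "u * t" t] by (simp add: mult_left_le_one_le)
  also have "\<dots> \<le> (1 + u) * Lam t"
    using assms Lam_pos[of t] by (intro mult_right_mono) auto
  finally show ?thesis .
next
  case False
  then have "Lam (u * t) / (u * t) \<le> Lam t / t"
    using assms by (intro Lam_div_antimono) auto
  then have "Lam (u * t) \<le> u * Lam t" using assms by (simp add: field_simps)
  also have "\<dots> \<le> (1 + u) * Lam t"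
    using assms Lam_pos[of t] by (intro mult_right_mono) auto
  finally show ?thesis .
qed

lemma Lam_tendsto_0: "(Lam \<longlongrightarrow> 0) (at_right 0)"
  unfolding Lam_def by real_asymp

lemma lam_at_top: "filterlim lam at_top (at_right 0)"
  unfolding lam_def by real_asymp

text \<open>The weighted function is - lam / lam', so its monotonicity expresses the log-convexity
  of \<open>lam\<close>.\<close>

lemma lam_weighted_mono:
  assumes "0 < s" "s \<le> t"
  shows "s * (1 + s) * lam s \<le> t * (1 + t) * lam t"
proof (rule DERIV_nonneg_imp_nondecreasing[OF assms(2)])
  fix x assume "s \<le> x"
  then have x: "0 < x" using assms by simp
  have "((\<lambda>t. t * (1 + t) * lam t) has_real_derivative (1 + 2 * x) * lam x - 1) (at x)"
    using x by (auto intro!: derivative_eq_intros DERIV_lam simp: divide_simps)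
  moreover have "1 \<le> (1 + 2 * x) * lam x"
  proof -
    have "1 \<le> (1 + 2 * x) * (1 / (1 + x))" using x by (simp add: field_simps)
    also have "\<dots> \<le> (1 + 2 * x) * lam x" using x by (intro mult_left_mono lam_ge) auto
    finally show ?thesis .
  qed
  ultimately show "\<exists>y. ((\<lambda>t. t * (1 + t) * lam t) has_real_derivative y) (at x) \<and> 0 \<le> y"
    by (intro exI conjI) auto
qed

lemma Lam_asymp_at_top: "0 < a \<Longrightarrow> ((\<lambda>t. Lam (a * t) / ln t) \<longlongrightarrow> 1) at_top"
  unfolding Lam_def by real_asymp

lemma Lam_asymp_at_0: "0 < a \<Longrightarrow> ((\<lambda>x. Lam (a * inverse x) / (inverse x * ln x)) \<longlongrightarrow> a) at_top"
  unfolding Lam_def by real_asymp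

section \<open>The kernel \<open>psi\<close> as the derivative of a power of
  \<open>Lam\<close>\<close>

definition Psi :: "real \<Rightarrow> real \<Rightarrow> real \<Rightarrow> real" where
  "Psi c \<delta> t = Lam (c * t) powr \<delta>"

definition psi :: "real \<Rightarrow> real \<Rightarrow> real \<Rightarrow> real" where
  "psi c \<delta> t = \<delta> * c * (Lam (c * t) powr (\<delta> - 1) * lam (c * t))"

lemma Psi_measurable [measurable]: "Psi c \<delta> \<in> borel_measurable borel"
  unfolding Psi_def by measurable

lemma psi_pos:
  assumes "0 < c" "0 < \<delta>" "0 < t"
  shows "0 < psi c \<delta> t"
  using assms Lam_pos[of "c * t"] lam_pos[of "c * t"] by (simp add: psi_def)

lemma DERIV_Psi:
  assumes "0 < c" "0 < t"
  shows "(Psi c \<delta> has_real_derivative psi c \<delta> t) (at t)"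
proof -
  have ct: "0 < c * t" using assms by simp
  from DERIV_fun_powr[OF DERIV_Lam_scaled[OF ct] Lam_pos[OF ct], of \<delta>]
  show ?thesis by (simp add: Psi_def[abs_def] psi_def mult_ac)
qed

lemma continuous_on_Lam: "continuous_on {0..} Lam"
  unfolding continuous_on_eq_continuous_within
proof
  fix x :: real assume "x \<in> {0..}"
  then consider "x = 0" | "x > 0" by fastforce
  then show "continuous (at x within {0..}) Lam"
  proof cases
    case 1
    then show ?thesis using Lam_tendsto_0 by (simp add: continuous_within at_within_Ici_at_right)
  next
    case 2
    then show ?thesis using DERIV_isCont[OF DERIV_Lam[OF 2]] continuous_at_imp_continuous_at_within by blast
  qed
qed

lemma continuous_on_Psi:
  assumes "0 < c" "0 < \<delta>"
  shows "continuous_on {0..} (Psi c \<delta>)"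
  unfolding Psi_def
proof (intro continuous_on_powr' continuous_intros ballI conjI impI)
  show "continuous_on {0..} (\<lambda>x. Lam (c * x))"
    by (rule continuous_on_compose2[OF continuous_on_Lam]) (use assms in \<open>auto intro!: continuous_intros\<close>)
qed (use assms in \<open>auto intro: Lam_nonneg\<close>)

text \<open>Both \<open>Lam\<close> to the power \<delta> - 1 and \<open>lam\<close> decrease
  because \<delta> is at most 1. Integrability comes from the primitive \<open>Psi\<close>, which is
  continuous up to 0. Near 0 the power of \<open>Lam\<close> is at least 1 and \<open>lam\<close>
  blows up, which includes the case \<delta> = 1.\<close>

lemma log_convex_kernel_psi:
  assumes c: "0 < c" and \<delta>: "0 < \<delta>" "\<delta> \<le> 1"
  shows "log_convex_kernel (psi c \<delta>)"
proof
  show "0 < psi c \<delta> t" if "0 < t" for t using psi_pos c \<delta> that by blast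
  show "psi c \<delta> t \<le> psi c \<delta> s" if "0 < s" "s \<le> t" for s t
  proof -
    have st: "0 < c * s" "c * s \<le> c * t" using that c by auto
    have "Lam (c * t) powr (\<delta> - 1) \<le> Lam (c * s) powr (\<delta> - 1)"
      using Lam_pos[OF st(1)] Lam_mono[OF st] \<delta> by (intro powr_mono2') auto
    moreover have "lam (c * t) \<le> lam (c * s)" "0 \<le> lam (c * t)"
      using lam_antimono[OF st] lam_pos[of "c * t"] st by auto
    ultimately show ?thesis
      unfolding psi_def using c \<delta> by (intro mult_left_mono mult_mono) auto
  qed
  show "convex_on {0<..} (\<lambda>t. ln (psi c \<delta> t))"
  proof (rule convex_on_realI)
    fix t :: real assume "t \<in> {0<..}"
    then have t: "0 < t" and ct: "0 < c * t" using c by auto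
    note pos = Lam_pos[OF ct] lam_pos[OF ct]
    have d: "((\<lambda>t. ln (\<delta> * c) + (\<delta> - 1) * ln (Lam (c * t)) + ln (lam (c * t))) has_real_derivative
       (\<delta> - 1) * (lam (c * t) * c / Lam (c * t)) + - 1 / (c * t * (1 + c * t)) * c / lam (c * t)) (at t)"
      using pos by (auto intro!: derivative_eq_intros DERIV_Lam_scaled[OF ct] DERIV_lam_scaled[OF ct] simp: divide_inverse)
    have ev: "eventually (\<lambda>t. ln (\<delta> * c) + (\<delta> - 1) * ln (Lam (c * t)) + ln (lam (c * t)) = ln (psi c \<delta> t)) (nhds t)"
    proof (rule eventually_mono[OF eventually_nhds_in_open[of "{0<..}"]])
      fix s :: real assume "s \<in> {0<..}"
      then have cs: "0 < c * s" using c by auto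
      show "ln (\<delta> * c) + (\<delta> - 1) * ln (Lam (c * s)) + ln (lam (c * s)) = ln (psi c \<delta> s)"
        using Lam_pos[OF cs] lam_pos[OF cs] c \<delta> by (simp add: psi_def ln_mult_pos ln_powr)
    qed (use t in auto)
    show "((\<lambda>t. ln (psi c \<delta> t)) has_real_derivative
       (\<delta> - 1) * (lam (c * t) * c / Lam (c * t)) + - 1 / (c * t * (1 + c * t)) * c / lam (c * t)) (at t)"
      using d DERIV_cong_ev[OF refl ev refl] by blast
  next
    fix x y :: real assume "x \<in> {0<..}" "y \<in> {0<..}" "x \<le> y"
    then have x: "0 < x" "0 < y" and xy: "0 < c * x" "0 < c * y" "c * x \<le> c * y" using c by auto
    note pos = Lam_pos[OF xy(1)] Lam_pos[OF xy(2)] lam_pos[OF xy(1)] lam_pos[OF xy(2)]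
    \<comment> \<open>The two summands of the logarithmic derivative increase separately: the first
      as lam / Lam decreases and \<delta> - 1 is nonpositive, the second by
      \<open>lam_weighted_mono\<close>.\<close>
    have "lam (c * y) * c / Lam (c * y) \<le> lam (c * x) * c / Lam (c * x)"
      using pos c Lam_mono[OF xy(1,3)] lam_antimono[OF xy(1,3)] by (intro frac_le) auto
    then have 1: "(\<delta> - 1) * (lam (c * x) * c / Lam (c * x)) \<le> (\<delta> - 1) * (lam (c * y) * c / Lam (c * y))"
      using \<delta> by (intro mult_left_mono_neg) auto
    have "c / (c * y * (1 + c * y) * lam (c * y)) \<le> c / (c * x * (1 + c * x) * lam (c * x))"
      using pos c x xy lam_weighted_mono[OF xy(1,3)] by (intro divide_left_mono mult_pos_pos add_pos_pos) auto
    then have 2: "- 1 / (c * x * (1 + c * x)) * c / lam (c * x) \<le> - 1 / (c * y * (1 + c * y)) * c / lam (c * y)"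
      using c by (simp add: mult_ac)
    from 1 2 show "(\<delta> - 1) * (lam (c * x) * c / Lam (c * x)) + - 1 / (c * x * (1 + c * x)) * c / lam (c * x)
      \<le> (\<delta> - 1) * (lam (c * y) * c / Lam (c * y)) + - 1 / (c * y * (1 + c * y)) * c / lam (c * y)"
      by (rule add_mono)
  qed simp
  show "psi c \<delta> integrable_on {a..b}" if a: "0 \<le> a" for a b
  proof (cases "a \<le> b")
    case True
    have "(psi c \<delta> has_integral Psi c \<delta> b - Psi c \<delta> a) {a..b}"
    proof (rule fundamental_theorem_of_calculus_interior[OF True])
      show "continuous_on {a..b} (Psi c \<delta>)"
        by (rule continuous_on_subset[OF continuous_on_Psi[OF c \<delta>(1)]]) (use a in auto)
      show "(Psi c \<delta> has_vector_derivative psi c \<delta> x) (at x)" if "x \<in> {a<..<b}" for x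
        using DERIV_Psi[OF c, of x] that a by (simp add: has_real_derivative_iff_has_vector_derivative)
    qed
    then show ?thesis by blast
  qed auto
  show "filterlim (psi c \<delta>) at_top (at_right 0)"
  proof (rule filterlim_at_top_mono)
    have scale: "filterlim (\<lambda>t. c * t) (at_right 0) (at_right 0)"
      using c by real_asymp
    have "filterlim (\<lambda>t. \<delta> * c * lam (c * t)) at_top (at_right 0)"
      using c \<delta> by (intro filterlim_tendsto_pos_mult_at_top[OF tendsto_const] filterlim_compose[OF lam_at_top scale]) auto
    then show "filterlim (\<lambda>t. \<delta> * c * lam (c * t)) at_top (at_right 0)" .
    have "eventually (\<lambda>t. Lam (c * t) < 1) (at_right 0)"
      by (rule order_tendstoD(2)[OF filterlim_compose[OF Lam_tendsto_0 scale]]) simp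
    moreover have "eventually (\<lambda>t::real. 0 < t) (at_right 0)" by (rule eventually_at_right_less)
    ultimately show "eventually (\<lambda>t. \<delta> * c * lam (c * t) \<le> psi c \<delta> t) (at_right 0)"
    proof eventually_elim
      case (elim t)
      then have ct: "0 < c * t" using c by simp
      have "1 powr (\<delta> - 1) \<le> Lam (c * t) powr (\<delta> - 1)"
        using elim Lam_pos[OF ct] \<delta> by (intro powr_mono2') auto
      then have "1 * lam (c * t) \<le> Lam (c * t) powr (\<delta> - 1) * lam (c * t)"
        using lam_pos[OF ct] by (intro mult_right_mono) auto
      then show ?case unfolding psi_def using c \<delta> by (intro mult_left_mono) auto
    qed
  qed
qed

section \<open>Laplace transforms of \<open>psi\<close> and their limits\<close>

lemma exp_powr_bound:
  fixes x :: real
  assumes "0 < \<delta>" "\<delta> \<le> 1" "0 \<le> u" "0 \<le> x" "x \<le> (1 + u) * M" "0 \<le> M"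
  shows "exp (- u) * x powr \<delta> \<le> (1 + 2 * M) * exp (- (1 / 2) * u)"
proof -
  have "x powr \<delta> \<le> 1 + x"
  proof (cases "x \<le> 1")
    case True
    then have "x powr \<delta> \<le> 1" using assms by (intro powr_le1) auto
    then show ?thesis using assms by simp
  next
    case False
    then have "x powr \<delta> \<le> x powr 1" using assms by (intro powr_mono) auto
    then show ?thesis using False by simp
  qed
  also have "\<dots> \<le> 1 + (1 + u) * M" using assms by simp
  \<comment> \<open>Half of the exponential decay is spent on absorbing the linear growth in
    u.\<close>
  also have "\<dots> \<le> exp (u / 2) + (2 * exp (u / 2)) * M"
  proof -
    have "1 + u \<le> 2 * exp (u / 2)" "1 \<le> exp (u / 2)"
      using exp_ge_add_one_self[of "u / 2"] assms(3) by linarith+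
    then show ?thesis using assms(6) by (intro add_mono mult_right_mono)
  qed
  also have "\<dots> = (1 + 2 * M) * exp (u / 2)" by (simp add: algebra_simps)
  finally have "exp (- u) * x powr \<delta> \<le> exp (- u) * ((1 + 2 * M) * exp (u / 2))" by simp
  also have "\<dots> = (1 + 2 * M) * exp (- (1 / 2) * u)"
    by (simp add: mult_exp_exp mult.left_commute[of _ "1 + 2 * M"])
  finally show ?thesis .
qed

context
  fixes c \<delta> :: real
  assumes c: "0 < c" and \<delta>: "0 < \<delta>" "\<delta> \<le> 1"
begin

lemma exp_Psi_bound:
  assumes "0 < t" "0 \<le> u"
  shows "exp (- u) * Psi c \<delta> (u * t) \<le> (1 + 2 * Lam (c * t)) * exp (- (1 / 2) * u)"
  unfolding Psi_def
proof (rule exp_powr_bound[OF \<delta> assms(2)])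
  show "Lam (c * (u * t)) \<le> (1 + u) * Lam (c * t)"
    using Lam_mult_le[of u "c * t"] Lam_pos[of "c * t"] assms c
    by (cases "u = 0") (auto simp: mult_ac)
qed (use assms c in \<open>auto intro: Lam_nonneg\<close>)

lemma exp_Psi_absolutely_integrable:
  assumes "0 < t"
  shows "(\<lambda>u. exp (- u) * Psi c \<delta> (u * t)) absolutely_integrable_on {0..}"
proof (rule measurable_bounded_by_integrable_imp_absolutely_integrable)
  have "(\<lambda>u. exp (- u) * Psi c \<delta> (u * t)) \<in> borel_measurable borel" by measurable
  then show "(\<lambda>u. exp (- u) * Psi c \<delta> (u * t)) \<in> borel_measurable (lebesgue_on {0..})"
    by (simp add: measurable_completion measurable_restrict_space1)
  show "(\<lambda>u. (1 + 2 * Lam (c * t)) * exp (- (1 / 2) * u)) integrable_on {0..}"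
    by (intro integrable_on_mult_right integrable_on_exp_minus_to_infinity) simp
  show "norm (exp (- u) * Psi c \<delta> (u * t)) \<le> (1 + 2 * Lam (c * t)) * exp (- (1 / 2) * u)" if "u \<in> {0..}" for u
    using exp_Psi_bound[OF assms, of u] that by (simp add: Psi_def)
qed simp

text \<open>Integration by parts replaces \<open>psi\<close> by \<open>Psi\<close>, and the
  substitution s = u * t moves t out of the exponential. The boundary terms vanish because
  \<open>Psi\<close> is 0 at 0 and w tends to 0 at infinity.\<close>

lemma laplace_psi:
  assumes t: "0 < t"
  shows "laplace_transform (psi c \<delta>) (inverse t) = integral {0..} (\<lambda>u. exp (- u) * Psi c \<delta> (u * t))"
proof -
  define w where "w u = exp (- u) * Psi c \<delta> (u * t)" for u
  define p where "p = inverse t"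
  have p: "0 < p" "p * t = 1" using t by (auto simp: p_def)
  have wint: "w absolutely_integrable_on {0..}"
    using exp_Psi_absolutely_integrable[OF t] by (simp add: w_def[abs_def])
  have w_tendsto: "((\<lambda>y. integral {0..y} w) \<longlongrightarrow> integral {0..} w) at_top"
  proof -
    have "((\<lambda>y. LINT x:{0..y}|lebesgue. w x) \<longlongrightarrow> (LINT x:{0..}|lebesgue. w x)) at_top"
      by (rule tendsto_set_lebesgue_integral_at_top[OF _ wint]) simp
    moreover have "(LINT x:{0..y}|lebesgue. w x) = integral {0..y} w" for y
      by (rule set_lebesgue_integral_eq_integral(2)[OF set_integrable_subset[OF wint]]) auto
    ultimately show ?thesis using set_lebesgue_integral_eq_integral(2)[OF wint] by simp
  qed
  have hint: "((\<lambda>s. exp (- p * s) * psi c \<delta> s) has_integral w (p * y) + integral {0..p * y} w) {0..y}"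
    if y: "0 \<le> y" for y
  proof -
    have "((\<lambda>s. exp (- p * s) * psi c \<delta> s - p * w (p * s)) has_integral
        exp (- p * y) * Psi c \<delta> y - exp (- p * 0) * Psi c \<delta> 0) {0..y}"
    proof (rule fundamental_theorem_of_calculus_interior[OF y])
      show "continuous_on {0..y} (\<lambda>s. exp (- p * s) * Psi c \<delta> s)"
        by (intro continuous_intros continuous_on_subset[OF continuous_on_Psi[OF c \<delta>(1)]]) auto
      fix s assume "s \<in> {0<..<y}"
      then have s: "0 < s" by simp
      have "p * s * t = s" using p by (metis mult.assoc mult.commute mult_1)
      then have w: "w (p * s) = exp (- p * s) * Psi c \<delta> s" unfolding w_def by (simp only: mult_minus_left)
      show "((\<lambda>s. exp (- p * s) * Psi c \<delta> s) has_vector_derivative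
          exp (- p * s) * psi c \<delta> s - p * w (p * s)) (at s)"
        unfolding has_real_derivative_iff_has_vector_derivative[symmetric] w
        by (auto intro!: derivative_eq_intros DERIV_Psi[OF c s] simp: algebra_simps)
    qed
    moreover have "((\<lambda>s. p * w (p * s)) has_integral integral {0..p * y} w) {0..y}"
    proof -
      have "(w has_integral integral {0..p * y} w) (cbox 0 (p * y))"
        using integrable_integral[of w "{0..p * y}"] integrable_on_subinterval[of w "{0..}" 0 "p * y"]
          set_lebesgue_integral_eq_integral(1)[OF wint] by auto
      from has_integral_mult_right[OF has_integral_affinity'[OF this p(1), of 0], of p]
      show ?thesis using p(1) by (simp add: mult.assoc[symmetric])
    qed
    ultimately have "((\<lambda>s. exp (- p * s) * psi c \<delta> s - p * w (p * s) + p * w (p * s)) has_integral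
        exp (- p * y) * Psi c \<delta> y - exp (- p * 0) * Psi c \<delta> 0 + integral {0..p * y} w) {0..y}"
      by (rule has_integral_add)
    moreover have "p * y * t = y" using p by (metis mult.assoc mult.commute mult_1)
    then have "w (p * y) = exp (- p * y) * Psi c \<delta> y" unfolding w_def by (simp only: mult_minus_left)
    ultimately show ?thesis by (simp add: Psi_def)
  qed
  have py: "filterlim (\<lambda>y. p * y) at_top at_top" using p by real_asymp
  have w0: "((\<lambda>y. w (p * y)) \<longlongrightarrow> 0) at_top"
  proof (rule tendsto_sandwich[of "\<lambda>_. 0"])
    show "eventually (\<lambda>y. w (p * y) \<le> (1 + 2 * Lam (c * t)) * exp (- (1 / 2) * (p * y))) at_top"
      using eventually_ge_at_top[of 0]
      by eventually_elim (use p in \<open>auto simp: w_def intro!: exp_Psi_bound[OF t, simplified]\<close>)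
    show "((\<lambda>y. (1 + 2 * Lam (c * t)) * exp (- (1 / 2) * (p * y))) \<longlongrightarrow> 0) at_top"
      using p by real_asymp
  qed (auto simp: w_def Psi_def)
  have "((\<lambda>s. exp (- p * s) * psi c \<delta> s) has_integral integral {0..} w) {0..}"
  proof (rule has_integral_to_inf)
    show "(\<lambda>s. exp (- p * s) * psi c \<delta> s) integrable_on {0..y}" for y
      using hint[of y] by (cases "0 \<le> y") auto
    have "((\<lambda>y. w (p * y) + integral {0..p * y} w) \<longlongrightarrow> 0 + integral {0..} w) at_top"
      by (intro tendsto_add w0 filterlim_compose[OF w_tendsto py])
    moreover have "eventually (\<lambda>y. w (p * y) + integral {0..p * y} w =
        integral {0..y} (\<lambda>s. exp (- p * s) * psi c \<delta> s)) at_top"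
      using eventually_ge_at_top[of 0] by eventually_elim (use integral_unique[OF hint] in auto)
    ultimately show "((\<lambda>y. integral {0..y} (\<lambda>s. exp (- p * s) * psi c \<delta> s)) \<longlongrightarrow> integral {0..} w) at_top"
      by (simp add: tendsto_cong)
    show "0 \<le> exp (- p * s) * psi c \<delta> s" if "0 \<le> s" for s
      using psi_pos[OF c \<delta>(1), of s] that by (cases "s = 0") (auto simp: psi_def)
  qed
  \<comment> \<open>Nonnegativity turns the improper integral into a Lebesgue integral; at s = 0 the
    default value of \<open>psi\<close> is 0.\<close>
  moreover have "0 \<le> exp (- p * s) * psi c \<delta> s" if "s \<in> {0..}" for s
    using psi_pos[OF c \<delta>(1), of s] that by (cases "s = 0") (auto simp: psi_def)
  ultimately have "(\<lambda>s. exp (- p * s) * psi c \<delta> s) absolutely_integrable_on {0..}"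
    "integral {0..} (\<lambda>s. exp (- p * s) * psi c \<delta> s) = integral {0..} w"
    by (auto intro!: nonnegative_absolutely_integrable_1 integral_unique)
  then show ?thesis
    unfolding laplace_transform_def w_def[symmetric] p_def[symmetric]
    by (metis set_lebesgue_integral_eq_integral(2))
qed

text \<open>One dominated convergence argument serves both ends: \<tau> is the argument running to
  infinity or to 0, d the normalisation of \<open>Lam\<close> and \<kappa> the limit profile after
  rescaling by u.\<close>

lemma laplace_psi_tendsto:
  fixes \<tau> d \<kappa> :: "real \<Rightarrow> real"
  assumes \<tau>: "eventually (\<lambda>i. 0 < \<tau> i) at_top" and d: "eventually (\<lambda>i. 0 < d i) at_top"
    and lim: "\<And>u. 0 < u \<Longrightarrow> ((\<lambda>i. Lam (c * u * \<tau> i) / d i) \<longlongrightarrow> \<kappa> u) at_top"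
    and [measurable]: "\<kappa> \<in> borel_measurable borel"
    and int: "((\<lambda>u. exp (- u) * \<kappa> u powr \<delta>) has_integral I) {0..}"
  shows "((\<lambda>i. laplace_transform (psi c \<delta>) (inverse (\<tau> i)) / d i powr \<delta>) \<longlongrightarrow> I) at_top"
proof -
  let ?M = "lebesgue_on {0<..} :: real measure"
  have Ioi: "(f has_integral y) {0..} \<longleftrightarrow> (f has_integral y) {0<..}" for f :: "real \<Rightarrow> real" and y
    by (rule has_integral_spike_set_eq) (auto intro: negligible_subset[of "{0}"])
  have meas: "f \<in> borel_measurable ?M" if "f \<in> borel_measurable borel" for f :: "real \<Rightarrow> real"
    using that by (simp add: measurable_completion measurable_restrict_space1)
  have LINT: "integral\<^sup>L ?M f = y"
    if "(f has_integral y) {0..}" "\<And>u. 0 < u \<Longrightarrow> 0 \<le> f u" for f :: "real \<Rightarrow> real" and y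
  proof -
    have "f absolutely_integrable_on {0<..}"
      using that by (intro nonnegative_absolutely_integrable_1) (auto simp: Ioi)
    from absolutely_integrable_imp_integrable[OF this] show ?thesis
      using that(1) by (simp add: lebesgue_integral_eq_integral Ioi integral_unique)
  qed
  define s where "s i u = exp (- u) * (Lam (c * u * \<tau> i) / d i) powr \<delta>" for i u
  have nonneg: "0 \<le> Lam (c * u * \<tau> i) / d i" if "0 < u" "0 < \<tau> i" "0 < d i" for u i
    using that c by (intro divide_nonneg_pos Lam_nonneg) auto
  \<comment> \<open>Any number above the limit at u = 1 works: \<open>Lam_mult_le\<close> extends
    the bound from u = 1 to all u > 0, at the price of a factor 1 + u.\<close>
  define M where "M = \<kappa> 1 + 1"
  have "eventually (\<lambda>i. Lam (c * 1 * \<tau> i) / d i < M) at_top"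
    by (rule order_tendstoD(2)[OF lim]) (auto simp: M_def)
  with \<tau> d have bound: "eventually (\<lambda>i. AE u in ?M. norm (s i u) \<le> (1 + 2 * M) * exp (- (1 / 2) * u)) at_top"
  proof eventually_elim
    case (elim i)
    have M: "0 \<le> M" using nonneg[of 1 i] elim by simp
    show ?case
    proof (rule AE_I2)
      fix u assume "u \<in> space ?M"
      then have u: "0 < u" by simp
      have "Lam (c * u * \<tau> i) \<le> (1 + u) * Lam (c * \<tau> i)"
        using Lam_mult_le[of u "c * \<tau> i"] u c elim by (simp add: mult_ac)
      then have "Lam (c * u * \<tau> i) / d i \<le> (1 + u) * Lam (c * \<tau> i) / d i"
        using elim by (simp add: divide_right_mono)
      also have "\<dots> \<le> (1 + u) * M"
        using elim u by (simp add: mult_left_mono flip: times_divide_eq_right)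
      finally show "norm (s i u) \<le> (1 + 2 * M) * exp (- (1 / 2) * u)"
        using exp_powr_bound[OF \<delta>, of u "Lam (c * u * \<tau> i) / d i" M] u M nonneg[of u i] elim
        by (simp add: s_def)
    qed
  qed
  have "((\<lambda>i. integral\<^sup>L ?M (s i)) \<longlongrightarrow> integral\<^sup>L ?M (\<lambda>u. exp (- u) * \<kappa> u powr \<delta>)) at_top"
  proof (rule integral_dominated_convergence_at_top[OF _ _ _ _ bound])
    show "(\<lambda>u. exp (- u) * \<kappa> u powr \<delta>) \<in> borel_measurable ?M" by (rule meas) measurable
    show "s i \<in> borel_measurable ?M" for i unfolding s_def by (rule meas) measurable
    have "(\<lambda>u::real. exp (- (1 / 2) * u)) absolutely_integrable_on {0<..}"
      using integrable_on_exp_minus_to_infinity[of "1/2" 0]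
      by (intro nonnegative_absolutely_integrable_1) (auto simp: integrable_on_def Ioi)
    then show "integrable ?M (\<lambda>u. (1 + 2 * M) * exp (- (1 / 2) * u))"
      by (intro integrable_mult_right absolutely_integrable_imp_integrable) auto
    show "AE u in ?M. ((\<lambda>i. s i u) \<longlongrightarrow> exp (- u) * \<kappa> u powr \<delta>) at_top"
    proof (rule AE_I2)
      fix u assume "u \<in> space ?M"
      then have u: "0 < u" by simp
      have "eventually (\<lambda>i. 0 \<le> Lam (c * u * \<tau> i) / d i) at_top"
        using \<tau> d by eventually_elim (use nonneg u in auto)
      then show "((\<lambda>i. s i u) \<longlongrightarrow> exp (- u) * \<kappa> u powr \<delta>) at_top"
        unfolding s_def using \<delta> by (intro tendsto_mult tendsto_const tendsto_powr'[OF lim[OF u]]) auto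
    qed
  qed
  also have "integral\<^sup>L ?M (\<lambda>u. exp (- u) * \<kappa> u powr \<delta>) = I"
    using int by (rule LINT) simp
  finally have *: "((\<lambda>i. integral\<^sup>L ?M (s i)) \<longlongrightarrow> I) at_top" .
  have "eventually (\<lambda>i. integral\<^sup>L ?M (s i) = laplace_transform (psi c \<delta>) (inverse (\<tau> i)) / d i powr \<delta>) at_top"
    using \<tau> d
  proof eventually_elim
    case (elim i)
    have "((\<lambda>u. exp (- u) * Psi c \<delta> (u * \<tau> i)) has_integral laplace_transform (psi c \<delta>) (inverse (\<tau> i))) {0..}"
      unfolding laplace_psi[OF elim(1)]
      by (intro integrable_integral set_lebesgue_integral_eq_integral(1) exp_Psi_absolutely_integrable elim)
    from has_integral_divide[OF this, of "d i powr \<delta>"]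
    have h: "((\<lambda>u. exp (- u) * Psi c \<delta> (u * \<tau> i) / d i powr \<delta>) has_integral
      laplace_transform (psi c \<delta>) (inverse (\<tau> i)) / d i powr \<delta>) {0..}" .
    have "(s i has_integral laplace_transform (psi c \<delta>) (inverse (\<tau> i)) / d i powr \<delta>) {0..}"
    proof (rule has_integral_eq[OF _ h])
      fix u :: real assume "u \<in> {0..}"
      then show "exp (- u) * Psi c \<delta> (u * \<tau> i) / d i powr \<delta> = s i u"
        using elim c by (simp add: s_def Psi_def powr_divide Lam_nonneg mult_ac)
    qed
    then show ?case by (rule LINT) (simp add: s_def)
  qed
  then show ?thesis using * by (rule Lim_transform_eventually[rotated])
qed

end

section \<open>The normalising scale and the conclusion\<close>

theorem corollary3p10:
  fixes \<delta> :: real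
  assumes "0 < \<delta>" and "\<delta> \<le> 1"
  shows "\<exists>\<phi> \<psi>. PC \<phi> \<psi> \<and>
    (\<lambda>t. laplace_transform \<psi> (inverse t)) \<sim>[at_top] (\<lambda>t. (ln t) powr \<delta>) \<and>
    (\<lambda>t. laplace_transform \<psi> (inverse t)) \<sim>[at_right 0] (\<lambda>t. (t * ln (inverse t)) powr \<delta>)"
proof -
  \<comment> \<open>This c solves c powr \<delta> * Gamma (\<delta> + 1) = 1, the left side being
    the limit of the quotient at 0; the limit at infinity is 1 for every c.\<close>
  define c where "c = (1 / Gamma (\<delta> + 1)) powr (1 / \<delta>)"
  have G: "0 < Gamma (\<delta> + 1)" using assms by (intro Gamma_real_pos) simp
  have c: "0 < c" using G by (simp add: c_def)
  have cG: "c powr \<delta> * Gamma (\<delta> + 1) = 1"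
    using G assms by (simp add: c_def powr_powr less_imp_neq[symmetric])
  obtain \<phi> where "PC \<phi> (psi c \<delta>)"
    using log_convex_kernel.ex_PC[OF log_convex_kernel_psi[OF c assms]] by blast
  moreover have "(\<lambda>t. laplace_transform (psi c \<delta>) (inverse t)) \<sim>[at_top] (\<lambda>t. (ln t) powr \<delta>)"
  proof (rule asymp_equivI', rule laplace_psi_tendsto[OF c assms, where \<kappa> = "\<lambda>_. 1"])
    show "((\<lambda>u. exp (- u) * 1 powr \<delta>) has_integral 1) {0..}"
      using has_integral_exp_minus_to_infinity[of 1 0] by simp
    show "eventually (\<lambda>i::real. 0 < ln i) at_top" by real_asymp
    show "((\<lambda>i. Lam (c * u * i) / ln i) \<longlongrightarrow> 1) at_top" if "0 < u" for u
      using c that by (intro Lam_asymp_at_top) simp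
  qed (auto intro: eventually_gt_at_top)
  moreover have "(\<lambda>t. laplace_transform (psi c \<delta>) (inverse t)) \<sim>[at_right 0] (\<lambda>t. (t * ln (inverse t)) powr \<delta>)"
  \<comment> \<open>The limit at 0 becomes one at infinity through t = inverse i. The profile is now
    linear in u, so the limiting integral is a Gamma integral.\<close>
  proof (rule asymp_equivI', unfold filterlim_at_right_to_top, rule laplace_psi_tendsto[OF c assms, where \<kappa> = "\<lambda>u. c * u"])
    have "((\<lambda>u. c powr \<delta> * (u powr (\<delta> + 1 - 1) / exp u)) has_integral c powr \<delta> * Gamma (\<delta> + 1)) {0..}"
      using assms by (intro has_integral_mult_right Gamma_integral_real) simp
    then show "((\<lambda>u. exp (- u) * (c * u) powr \<delta>) has_integral 1) {0..}"
      unfolding cG by (rule has_integral_eq[rotated]) (use c in \<open>simp add: powr_mult exp_minus field_simps\<close>)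
    show "eventually (\<lambda>i::real. 0 < inverse i) at_top" by real_asymp
    show "eventually (\<lambda>i::real. 0 < inverse i * ln (inverse (inverse i))) at_top" by real_asymp
    show "((\<lambda>i. Lam (c * u * inverse i) / (inverse i * ln (inverse (inverse i)))) \<longlongrightarrow> c * u) at_top" if "0 < u" for u
      using Lam_asymp_at_0[of "c * u"] c that by simp
  qed simp
  ultimately show ?thesis by blast
qed

end
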